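(* Let $(\mathcal C,\otimes,\mathbb 1,c)$ be a braided monoidal category with an object $X\in\mathcal C$, and let $(\mathcal M,\triangleright,e)$ be a symmetric left $\mathcal C$-module category with an object $M\in\mathcal M$. For each $n\ge2$, the following assignment defines a representation (group homomorphism) of the braid group of type D: $$\rho_n^{X,M}:\mathrm{Br}_n^{\mathrm D}\to\mathrm{Aut}_{\mathcal M}(X^{\otimes n}\triangleright M),$$ $$\sigma_i\mapsto\mathrm{id}_{X^{\otimes i-1}}\otimes c_{X,X}\otimes\mathrm{id}_{X^{\otimes n-i-1}\triangleright M},$$ $$t\mapsto\mathrm{id}_{X^{\otimes n-2}}\otimes\big[(\mathrm{id}_X\otimes e_{X,M})(c_{X,X}\triangleright\mathrm{id}_M)(\mathrm{id}_X\otimes e_{X,M})\big].$$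
   Context: Categories and functors are $\Bbbk$-linear, $\Bbbk$ an algebraically closed field of characteristic zero. Monoidal categories and module categories are assumed strict. Symbols such as $\mathrm{id}_X\otimes f$ for $f$ a morphism of $\mathcal M$ mean $\mathrm{id}_X\triangleright f$. A braided monoidal category has natural isomorphisms $c_{X,Y}:X\otimes Y\to Y\otimes X$ with $c_{X,Y\otimes Z}=(\mathrm{id}_Y\otimes c_{X,Z})(c_{X,Y}\otimes\mathrm{id}_Z)$ and $c_{X\otimes Y,Z}=(c_{X,Z}\otimes\mathrm{id}_Y)(\mathrm{id}_X\otimes c_{Y,Z})$. A left $\mathcal C$-module category $(\mathcal M,\triangleright)$ is braided if equipped with a natural isomorphism $e_{X,M}:X\triangleright M\to X\triangleright M$ such that for all $X,Y\in\mathcal C$, $M\in\mathcal M$: $e_{X\otimes Y,M}=(\mathrm{id}_X\otimes e_{Y,M})(c_{Y,X}\triangleright\mathrm{id}_M)(\mathrm{id}_Y\otimes e_{X,M})(c_{Y,X}^{-1}\triangleright\mathrm{id}_M)$ and $e_{X,Y\triangleright M}=(c_{Y,X}\triangleright\mathrm{id}_M)(\mathrm{id}_Y\otimes e_{X,M})(c_{X,Y}\triangleright\mathrm{id}_M)$. It is symmetric if it is braided and $e_{X,M}=e_{X,M}^{-1}$ for all $X,M$. $\mathrm{Br}_n^{\mathrm D}$ is the group generated by $\sigma_1,\dots,\sigma_{n-1},t$ with relations $\sigma_i\sigma_{i+1}\sigma_i=\sigma_{i+1}\sigma_i\sigma_{i+1}$ ($1\le i\le n-2$), $\sigma_i\sigma_j=\sigma_j\sigma_i$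 ($|i-j|\ge2$), $\sigma_it=t\sigma_i$ ($i=1,\dots,n-3$ and $i=n-1$), $\sigma_{n-2}t\sigma_{n-2}=t\sigma_{n-2}t$ (the last one for $n\ge3$). *)

theory Defs
  imports "HOL-Algebra.Algebra"
begin

section \<open>Linear categories\<close>

definition characteristic_zero :: "('k, 'z) ring_scheme \<Rightarrow> bool" where
  "characteristic_zero K \<longleftrightarrow> (\<forall>m::nat. m > 0 \<longrightarrow> [m] \<cdot>\<^bsub>K\<^esub> \<one>\<^bsub>K\<^esub> \<noteq> \<zero>\<^bsub>K\<^esub>)"

definition linear_map ::
  "('k, 'z) ring_scheme \<Rightarrow> ('k, 'a, 'v) module_scheme \<Rightarrow> ('k, 'b, 'w) module_scheme \<Rightarrow> ('a \<Rightarrow> 'b) \<Rightarrow> bool"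
  where
  "linear_map K V W f \<longleftrightarrow>
     f \<in> carrier V \<rightarrow> carrier W \<and>
     (\<forall>v\<in>carrier V. \<forall>v'\<in>carrier V. f (v \<oplus>\<^bsub>V\<^esub> v') = f v \<oplus>\<^bsub>W\<^esub> f v') \<and>
     (\<forall>a\<in>carrier K. \<forall>v\<in>carrier V. f (a \<odot>\<^bsub>V\<^esub> v) = a \<odot>\<^bsub>W\<^esub> f v)"

text \<open>Each hom-set is the carrier of a module over the ground field; the ring multiplication and
  unit that the library's module record inherits are never used. Composition is written in the
  functional order: \<open>g \<bullet>\<^bsub>C\<^esub> f\<close> is \<open>g\<close> after \<open>f\<close>.\<close>

record ('o, 'm, 'k) lin_cat =
  Obj :: "'o set"
  Hom :: "'o \<Rightarrow> 'o \<Rightarrow> ('k, 'm) module"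
  ident :: "'o \<Rightarrow> 'm"
  arr_comp :: "'m \<Rightarrow> 'm \<Rightarrow> 'm"  (infixr \<open>\<bullet>\<index>\<close> 65)

abbreviation hom_set :: "('o, 'm, 'k, 'z) lin_cat_scheme \<Rightarrow> 'o \<Rightarrow> 'o \<Rightarrow> 'm set" where
  "hom_set C V Y \<equiv> carrier (Hom C V Y)"

locale linear_category = field K
  for K :: "('k, 'y) ring_scheme" and C :: "('o, 'm, 'k, 'z) lin_cat_scheme" +
  assumes hom_module: "\<lbrakk>V \<in> Obj C; Y \<in> Obj C\<rbrakk> \<Longrightarrow> module K (Hom C V Y)"
    and hom_disjoint: "\<lbrakk>V \<in> Obj C; Y \<in> Obj C; V' \<in> Obj C; Y' \<in> Obj C;
      f \<in> hom_set C V Y; f \<in> hom_set C V' Y'\<rbrakk> \<Longrightarrow> V = V' \<and> Y = Y'"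
    and ident_in_hom: "V \<in> Obj C \<Longrightarrow> ident C V \<in> hom_set C V V"
    and comp_in_hom: "\<lbrakk>V \<in> Obj C; Y \<in> Obj C; Z \<in> Obj C; f \<in> hom_set C V Y; g \<in> hom_set C Y Z\<rbrakk>
      \<Longrightarrow> g \<bullet>\<^bsub>C\<^esub> f \<in> hom_set C V Z"
    and comp_assoc: "\<lbrakk>W \<in> Obj C; V \<in> Obj C; Y \<in> Obj C; Z \<in> Obj C;
      f \<in> hom_set C W V; g \<in> hom_set C V Y; h \<in> hom_set C Y Z\<rbrakk>
      \<Longrightarrow> (h \<bullet>\<^bsub>C\<^esub> g) \<bullet>\<^bsub>C\<^esub> f = h \<bullet>\<^bsub>C\<^esub> (g \<bullet>\<^bsub>C\<^esub> f)"
    and comp_ident_left: "\<lbrakk>V \<in> Obj C; Y \<in> Obj C; f \<in> hom_set C V Y\<rbrakk> \<Longrightarrow> ident C Y \<bullet>\<^bsub>C\<^esub> f = f"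
    and comp_ident_right: "\<lbrakk>V \<in> Obj C; Y \<in> Obj C; f \<in> hom_set C V Y\<rbrakk> \<Longrightarrow> f \<bullet>\<^bsub>C\<^esub> ident C V = f"
    and comp_linear_left: "\<lbrakk>V \<in> Obj C; Y \<in> Obj C; Z \<in> Obj C; f \<in> hom_set C V Y\<rbrakk>
      \<Longrightarrow> linear_map K (Hom C Y Z) (Hom C V Z) (\<lambda>g. g \<bullet>\<^bsub>C\<^esub> f)"
    and comp_linear_right: "\<lbrakk>V \<in> Obj C; Y \<in> Obj C; Z \<in> Obj C; g \<in> hom_set C Y Z\<rbrakk>
      \<Longrightarrow> linear_map K (Hom C V Y) (Hom C V Z) (\<lambda>f. g \<bullet>\<^bsub>C\<^esub> f)"

definition inverse_arrows :: "('o, 'm, 'k, 'z) lin_cat_scheme \<Rightarrow> 'o \<Rightarrow> 'o \<Rightarrow> 'm \<Rightarrow> 'm \<Rightarrow> bool" where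
  "inverse_arrows C V Y f g \<longleftrightarrow> f \<in> hom_set C V Y \<and> g \<in> hom_set C Y V \<and>
     g \<bullet>\<^bsub>C\<^esub> f = ident C V \<and> f \<bullet>\<^bsub>C\<^esub> g = ident C Y"

definition iso_arrow :: "('o, 'm, 'k, 'z) lin_cat_scheme \<Rightarrow> 'o \<Rightarrow> 'o \<Rightarrow> 'm \<Rightarrow> bool" where
  "iso_arrow C V Y f \<longleftrightarrow> (\<exists>g. inverse_arrows C V Y f g)"

definition inv_arrow :: "('o, 'm, 'k, 'z) lin_cat_scheme \<Rightarrow> 'o \<Rightarrow> 'o \<Rightarrow> 'm \<Rightarrow> 'm" where
  "inv_arrow C V Y f = (THE g. inverse_arrows C V Y f g)"

definition End_monoid :: "('o, 'm, 'k, 'z) lin_cat_scheme \<Rightarrow> 'o \<Rightarrow> 'm monoid" where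
  "End_monoid C V = \<lparr>carrier = hom_set C V V, monoid.mult = arr_comp C, one = ident C V\<rparr>"

definition Aut_group :: "('o, 'm, 'k, 'z) lin_cat_scheme \<Rightarrow> 'o \<Rightarrow> 'm monoid" where
  "Aut_group C V = units_of (End_monoid C V)"

lemma (in linear_category) group_Aut_group:
  assumes "V \<in> Obj C"
  shows "group (Aut_group C V)"
proof -
  have "monoid (End_monoid C V)"
    by (rule monoidI)
      (use assms in \<open>auto simp: End_monoid_def intro: ident_in_hom comp_in_hom comp_assoc
        comp_ident_left comp_ident_right\<close>)
  then show ?thesis
    unfolding Aut_group_def by (rule monoid.units_group)
qed

text \<open>A functor \<open>A \<times> B \<rightarrow> D\<close> that is linear in each of its two arguments.\<close>

locale bilinear_bifunctor =
  A: linear_category K A + B: linear_category K B + D: linear_category K D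
  for K :: "('k, 'y) ring_scheme"
    and A :: "('oa, 'ma, 'k, 'za) lin_cat_scheme"
    and B :: "('ob, 'mb, 'k, 'zb) lin_cat_scheme"
    and D :: "('od, 'md, 'k, 'zd) lin_cat_scheme" +
  fixes Fo :: "'oa \<Rightarrow> 'ob \<Rightarrow> 'od" and Fa :: "'ma \<Rightarrow> 'mb \<Rightarrow> 'md"
  assumes map_obj: "\<lbrakk>V \<in> Obj A; Y \<in> Obj B\<rbrakk> \<Longrightarrow> Fo V Y \<in> Obj D"
    and map_hom: "\<lbrakk>V \<in> Obj A; V' \<in> Obj A; Y \<in> Obj B; Y' \<in> Obj B;
      f \<in> hom_set A V V'; g \<in> hom_set B Y Y'\<rbrakk> \<Longrightarrow> Fa f g \<in> hom_set D (Fo V Y) (Fo V' Y')"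
    and map_ident: "\<lbrakk>V \<in> Obj A; Y \<in> Obj B\<rbrakk> \<Longrightarrow> Fa (ident A V) (ident B Y) = ident D (Fo V Y)"
    and map_comp: "\<lbrakk>V \<in> Obj A; V' \<in> Obj A; V'' \<in> Obj A; Y \<in> Obj B; Y' \<in> Obj B; Y'' \<in> Obj B;
      f \<in> hom_set A V V'; f' \<in> hom_set A V' V''; g \<in> hom_set B Y Y'; g' \<in> hom_set B Y' Y''\<rbrakk>
      \<Longrightarrow> Fa (f' \<bullet>\<^bsub>A\<^esub> f) (g' \<bullet>\<^bsub>B\<^esub> g) = Fa f' g' \<bullet>\<^bsub>D\<^esub> Fa f g"
    and map_linear_left: "\<lbrakk>V \<in> Obj A; V' \<in> Obj A; Y \<in> Obj B; Y' \<in> Obj B; g \<in> hom_set B Y Y'\<rbrakk>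
      \<Longrightarrow> linear_map K (Hom A V V') (Hom D (Fo V Y) (Fo V' Y')) (\<lambda>f. Fa f g)"
    and map_linear_right: "\<lbrakk>V \<in> Obj A; V' \<in> Obj A; Y \<in> Obj B; Y' \<in> Obj B; f \<in> hom_set A V V'\<rbrakk>
      \<Longrightarrow> linear_map K (Hom B Y Y') (Hom D (Fo V Y) (Fo V' Y')) (\<lambda>g. Fa f g)"


section \<open>Strict braided monoidal categories\<close>

text \<open>The subscripts \<open>o\<close> and \<open>a\<close> distinguish the values of a bifunctor on objects and on arrows.\<close>

record ('o, 'm, 'k) mon_cat = "('o, 'm, 'k) lin_cat" +
  tensor_obj :: "'o \<Rightarrow> 'o \<Rightarrow> 'o"  (infixr \<open>\<otimes>\<^sub>o\<index>\<close> 70)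
  tensor_arr :: "'m \<Rightarrow> 'm \<Rightarrow> 'm"  (infixr \<open>\<otimes>\<^sub>a\<index>\<close> 70)
  unit_obj :: "'o"

record ('o, 'm, 'k) braided_cat = "('o, 'm, 'k) mon_cat" +
  braiding :: "'o \<Rightarrow> 'o \<Rightarrow> 'm"

locale strict_monoidal_category =
  bilinear_bifunctor K C C C "tensor_obj C" "tensor_arr C"
  for K :: "('k, 'y) ring_scheme" and C :: "('o, 'm, 'k, 'z) mon_cat_scheme" +
  assumes unit_in_Obj: "unit_obj C \<in> Obj C"
    and tensor_obj_assoc: "\<lbrakk>V \<in> Obj C; Y \<in> Obj C; Z \<in> Obj C\<rbrakk>
      \<Longrightarrow> (V \<otimes>\<^sub>o\<^bsub>C\<^esub> Y) \<otimes>\<^sub>o\<^bsub>C\<^esub> Z = V \<otimes>\<^sub>o\<^bsub>C\<^esub> (Y \<otimes>\<^sub>o\<^bsub>C\<^esub> Z)"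
    and tensor_obj_unit_left: "V \<in> Obj C \<Longrightarrow> unit_obj C \<otimes>\<^sub>o\<^bsub>C\<^esub> V = V"
    and tensor_obj_unit_right: "V \<in> Obj C \<Longrightarrow> V \<otimes>\<^sub>o\<^bsub>C\<^esub> unit_obj C = V"
    and tensor_arr_assoc: "\<lbrakk>V \<in> Obj C; V' \<in> Obj C; Y \<in> Obj C; Y' \<in> Obj C; Z \<in> Obj C; Z' \<in> Obj C;
      f \<in> hom_set C V V'; g \<in> hom_set C Y Y'; h \<in> hom_set C Z Z'\<rbrakk>
      \<Longrightarrow> (f \<otimes>\<^sub>a\<^bsub>C\<^esub> g) \<otimes>\<^sub>a\<^bsub>C\<^esub> h = f \<otimes>\<^sub>a\<^bsub>C\<^esub> (g \<otimes>\<^sub>a\<^bsub>C\<^esub> h)"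
    and tensor_arr_unit_left: "\<lbrakk>V \<in> Obj C; V' \<in> Obj C; f \<in> hom_set C V V'\<rbrakk>
      \<Longrightarrow> ident C (unit_obj C) \<otimes>\<^sub>a\<^bsub>C\<^esub> f = f"
    and tensor_arr_unit_right: "\<lbrakk>V \<in> Obj C; V' \<in> Obj C; f \<in> hom_set C V V'\<rbrakk>
      \<Longrightarrow> f \<otimes>\<^sub>a\<^bsub>C\<^esub> ident C (unit_obj C) = f"

locale braided_monoidal_category = strict_monoidal_category K C
  for K :: "('k, 'y) ring_scheme" and C :: "('o, 'm, 'k, 'z) braided_cat_scheme" +
  assumes braiding_iso: "\<lbrakk>V \<in> Obj C; Y \<in> Obj C\<rbrakk>
      \<Longrightarrow> iso_arrow C (V \<otimes>\<^sub>o\<^bsub>C\<^esub> Y) (Y \<otimes>\<^sub>o\<^bsub>C\<^esub> V) (braiding C V Y)"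
    and braiding_natural: "\<lbrakk>V \<in> Obj C; V' \<in> Obj C; Y \<in> Obj C; Y' \<in> Obj C;
      f \<in> hom_set C V V'; g \<in> hom_set C Y Y'\<rbrakk>
      \<Longrightarrow> braiding C V' Y' \<bullet>\<^bsub>C\<^esub> (f \<otimes>\<^sub>a\<^bsub>C\<^esub> g) = (g \<otimes>\<^sub>a\<^bsub>C\<^esub> f) \<bullet>\<^bsub>C\<^esub> braiding C V Y"
    and braiding_tensor_right: "\<lbrakk>V \<in> Obj C; Y \<in> Obj C; Z \<in> Obj C\<rbrakk>
      \<Longrightarrow> braiding C V (Y \<otimes>\<^sub>o\<^bsub>C\<^esub> Z) =
        (ident C Y \<otimes>\<^sub>a\<^bsub>C\<^esub> braiding C V Z) \<bullet>\<^bsub>C\<^esub> (braiding C V Y \<otimes>\<^sub>a\<^bsub>C\<^esub> ident C Z)"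
    and braiding_tensor_left: "\<lbrakk>V \<in> Obj C; Y \<in> Obj C; Z \<in> Obj C\<rbrakk>
      \<Longrightarrow> braiding C (V \<otimes>\<^sub>o\<^bsub>C\<^esub> Y) Z =
        (braiding C V Z \<otimes>\<^sub>a\<^bsub>C\<^esub> ident C Y) \<bullet>\<^bsub>C\<^esub> (ident C V \<otimes>\<^sub>a\<^bsub>C\<^esub> braiding C Y Z)"

primrec tensor_pow :: "('o, 'm, 'k, 'z) mon_cat_scheme \<Rightarrow> 'o \<Rightarrow> nat \<Rightarrow> 'o" where
  "tensor_pow C V 0 = unit_obj C"
| "tensor_pow C V (Suc n) = V \<otimes>\<^sub>o\<^bsub>C\<^esub> tensor_pow C V n"


section \<open>Module categories\<close>

text \<open>The type parameters \<open>'co\<close> and \<open>'cm\<close> are those of the objects and arrows of the acting category;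
  \<open>mod_braiding M V N\<close> is the arrow \<open>e\<^bsub>V,N\<^esub>\<close>.\<close>

record ('o, 'm, 'k, 'co, 'cm) mod_cat = "('o, 'm, 'k) lin_cat" +
  act_obj :: "'co \<Rightarrow> 'o \<Rightarrow> 'o"  (infixr \<open>\<triangleright>\<^sub>o\<index>\<close> 68)
  act_arr :: "'cm \<Rightarrow> 'm \<Rightarrow> 'm"  (infixr \<open>\<triangleright>\<^sub>a\<index>\<close> 68)

record ('o, 'm, 'k, 'co, 'cm) braided_mod_cat = "('o, 'm, 'k, 'co, 'cm) mod_cat" +
  mod_braiding :: "'co \<Rightarrow> 'o \<Rightarrow> 'm"

locale strict_module_category =
  C: strict_monoidal_category K C + bilinear_bifunctor K C M M "act_obj M" "act_arr M"
  for K :: "('k, 'y) ring_scheme" and C :: "('co, 'cm, 'k, 'z) mon_cat_scheme"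
    and M :: "('o, 'm, 'k, 'co, 'cm, 'w) mod_cat_scheme" +
  assumes act_obj_assoc: "\<lbrakk>V \<in> Obj C; Y \<in> Obj C; N \<in> Obj M\<rbrakk>
      \<Longrightarrow> (V \<otimes>\<^sub>o\<^bsub>C\<^esub> Y) \<triangleright>\<^sub>o\<^bsub>M\<^esub> N = V \<triangleright>\<^sub>o\<^bsub>M\<^esub> (Y \<triangleright>\<^sub>o\<^bsub>M\<^esub> N)"
    and act_obj_unit: "N \<in> Obj M \<Longrightarrow> unit_obj C \<triangleright>\<^sub>o\<^bsub>M\<^esub> N = N"
    and act_arr_assoc: "\<lbrakk>V \<in> Obj C; V' \<in> Obj C; Y \<in> Obj C; Y' \<in> Obj C; N \<in> Obj M; N' \<in> Obj M;
      f \<in> hom_set C V V'; g \<in> hom_set C Y Y'; h \<in> hom_set M N N'\<rbrakk>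
      \<Longrightarrow> (f \<otimes>\<^sub>a\<^bsub>C\<^esub> g) \<triangleright>\<^sub>a\<^bsub>M\<^esub> h = f \<triangleright>\<^sub>a\<^bsub>M\<^esub> (g \<triangleright>\<^sub>a\<^bsub>M\<^esub> h)"
    and act_arr_unit: "\<lbrakk>N \<in> Obj M; N' \<in> Obj M; h \<in> hom_set M N N'\<rbrakk>
      \<Longrightarrow> ident C (unit_obj C) \<triangleright>\<^sub>a\<^bsub>M\<^esub> h = h"

locale braided_module_category =
  C: braided_monoidal_category K C + strict_module_category K C M
  for K :: "('k, 'y) ring_scheme" and C :: "('co, 'cm, 'k, 'z) braided_cat_scheme"
    and M :: "('o, 'm, 'k, 'co, 'cm, 'w) braided_mod_cat_scheme" +
  assumes mod_braiding_iso: "\<lbrakk>V \<in> Obj C; N \<in> Obj M\<rbrakk>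
      \<Longrightarrow> iso_arrow M (V \<triangleright>\<^sub>o\<^bsub>M\<^esub> N) (V \<triangleright>\<^sub>o\<^bsub>M\<^esub> N) (mod_braiding M V N)"
    and mod_braiding_natural: "\<lbrakk>V \<in> Obj C; V' \<in> Obj C; N \<in> Obj M; N' \<in> Obj M;
      f \<in> hom_set C V V'; h \<in> hom_set M N N'\<rbrakk>
      \<Longrightarrow> mod_braiding M V' N' \<bullet>\<^bsub>M\<^esub> (f \<triangleright>\<^sub>a\<^bsub>M\<^esub> h) = (f \<triangleright>\<^sub>a\<^bsub>M\<^esub> h) \<bullet>\<^bsub>M\<^esub> mod_braiding M V N"
    and mod_braiding_tensor: "\<lbrakk>V \<in> Obj C; Y \<in> Obj C; N \<in> Obj M\<rbrakk>
      \<Longrightarrow> mod_braiding M (V \<otimes>\<^sub>o\<^bsub>C\<^esub> Y) N =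
        (ident C V \<triangleright>\<^sub>a\<^bsub>M\<^esub> mod_braiding M Y N) \<bullet>\<^bsub>M\<^esub>
        (braiding C Y V \<triangleright>\<^sub>a\<^bsub>M\<^esub> ident M N) \<bullet>\<^bsub>M\<^esub>
        (ident C Y \<triangleright>\<^sub>a\<^bsub>M\<^esub> mod_braiding M V N) \<bullet>\<^bsub>M\<^esub>
        (inv_arrow C (Y \<otimes>\<^sub>o\<^bsub>C\<^esub> V) (V \<otimes>\<^sub>o\<^bsub>C\<^esub> Y) (braiding C Y V) \<triangleright>\<^sub>a\<^bsub>M\<^esub> ident M N)"
    and mod_braiding_act: "\<lbrakk>V \<in> Obj C; Y \<in> Obj C; N \<in> Obj M\<rbrakk>
      \<Longrightarrow> mod_braiding M V (Y \<triangleright>\<^sub>o\<^bsub>M\<^esub> N) =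
        (braiding C Y V \<triangleright>\<^sub>a\<^bsub>M\<^esub> ident M N) \<bullet>\<^bsub>M\<^esub>
        (ident C Y \<triangleright>\<^sub>a\<^bsub>M\<^esub> mod_braiding M V N) \<bullet>\<^bsub>M\<^esub>
        (braiding C V Y \<triangleright>\<^sub>a\<^bsub>M\<^esub> ident M N)"

locale symmetric_module_category = braided_module_category K C M
  for K :: "('k, 'y) ring_scheme" and C :: "('co, 'cm, 'k, 'z) braided_cat_scheme"
    and M :: "('o, 'm, 'k, 'co, 'cm, 'w) braided_mod_cat_scheme" +
  assumes mod_braiding_self_inverse: "\<lbrakk>V \<in> Obj C; N \<in> Obj M\<rbrakk>
      \<Longrightarrow> mod_braiding M V N = inv_arrow M (V \<triangleright>\<^sub>o\<^bsub>M\<^esub> N) (V \<triangleright>\<^sub>o\<^bsub>M\<^esub> N) (mod_braiding M V N)"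


section \<open>Groups given by generators and relations\<close>

text \<open>A word is a list of signed letters: \<open>(x, True)\<close> stands for the generator \<open>x\<close> and \<open>(x, False)\<close>
  for its formal inverse. A pair \<open>(l, r)\<close> in \<open>R\<close> is the relation \<open>l = r\<close>. The group \<open>\<langle>S | R\<rangle>\<close> is the
  quotient of the monoid of words over \<open>S\<close> by the least congruence that contains \<open>R\<close> and cancels
  adjacent inverse letters.\<close>

type_synonym 'g word = "('g \<times> bool) list"

definition words :: "'g set \<Rightarrow> 'g word set" where
  "words S = lists (S \<times> UNIV)"

inductive_set word_cong :: "'g set \<Rightarrow> ('g word \<times> 'g word) set \<Rightarrow> ('g word \<times> 'g word) set"
  for S :: "'g set" and R :: "('g word \<times> 'g word) set" where
  refl: "w \<in> words S \<Longrightarrow> (w, w) \<in> word_cong S R"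
| sym: "(v, w) \<in> word_cong S R \<Longrightarrow> (w, v) \<in> word_cong S R"
| trans: "\<lbrakk>(u, v) \<in> word_cong S R; (v, w) \<in> word_cong S R\<rbrakk> \<Longrightarrow> (u, w) \<in> word_cong S R"
| cancel: "\<lbrakk>u \<in> words S; v \<in> words S; x \<in> S\<rbrakk>
    \<Longrightarrow> (u @ [(x, b), (x, \<not> b)] @ v, u @ v) \<in> word_cong S R"
| relation: "\<lbrakk>u \<in> words S; v \<in> words S; (l, r) \<in> R; l \<in> words S; r \<in> words S\<rbrakk>
    \<Longrightarrow> (u @ l @ v, u @ r @ v) \<in> word_cong S R"

definition presented_group :: "'g set \<Rightarrow> ('g word \<times> 'g word) set \<Rightarrow> 'g word set monoid" where
  "presented_group S R =
     \<lparr>carrier = words S // word_cong S R,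
      monoid.mult = (\<lambda>A B. \<Union>a\<in>A. \<Union>b\<in>B. word_cong S R `` {a @ b}),
      one = word_cong S R `` {[]}\<rparr>"

definition presented_gen :: "'g set \<Rightarrow> ('g word \<times> 'g word) set \<Rightarrow> 'g \<Rightarrow> 'g word set" where
  "presented_gen S R x = word_cong S R `` {[(x, True)]}"

lemma word_cong_words: "(v, w) \<in> word_cong S R \<Longrightarrow> v \<in> words S \<and> w \<in> words S"
  by (induction rule: word_cong.induct) (auto simp: words_def)

lemma equiv_word_cong: "equiv (words S) (word_cong S R)"
proof (rule equivI)
  show "word_cong S R \<subseteq> words S \<times> words S"
    using word_cong_words by fast
  show "refl_on (words S) (word_cong S R)"
    by (rule refl_onI) (rule word_cong.refl)
  show "sym (word_cong S R)"
    by (rule symI) (rule word_cong.sym)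
  show "trans (word_cong S R)"
    by (rule transI) (rule word_cong.trans)
qed

lemma word_cong_context:
  "\<lbrakk>(v, w) \<in> word_cong S R; p \<in> words S; q \<in> words S\<rbrakk> \<Longrightarrow> (p @ v @ q, p @ w @ q) \<in> word_cong S R"
proof (induction rule: word_cong.induct)
  case (refl w)
  then show ?case by (auto intro!: word_cong.refl simp: words_def)
next
  case (sym v w)
  then show ?case by (simp add: word_cong.sym)
next
  case (trans u v w)
  then show ?case using word_cong.trans by metis
next
  case (cancel u v x b)
  then show ?case
    using word_cong.cancel[of "p @ u" S "v @ q" x b R] by (auto simp: words_def)
next
  case (relation u v l r)
  then show ?case
    using word_cong.relation[of "p @ u" S "v @ q" l r R] by (auto simp: words_def)
qed

lemma presented_mult:
  assumes "v \<in> words S" "w \<in> words S"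
  shows "word_cong S R `` {v} \<otimes>\<^bsub>presented_group S R\<^esub> word_cong S R `` {w} = word_cong S R `` {v @ w}"
proof -
  have cong: "(v @ w, v' @ w') \<in> word_cong S R"
    if vv': "(v, v') \<in> word_cong S R" and ww': "(w, w') \<in> word_cong S R" for v' w'
  proof -
    have Nil: "[] \<in> words S" by (simp add: words_def)
    have "(v @ w, v' @ w) \<in> word_cong S R"
      using word_cong_context[OF vv' Nil assms(2)] by simp
    moreover have "(v' @ w, v' @ w') \<in> word_cong S R"
      using word_cong_context[OF ww' conjunct2[OF word_cong_words[OF vv']] Nil] by simp
    ultimately show ?thesis by (rule word_cong.trans)
  qed
  have eq: "word_cong S R `` {v' @ w'} = word_cong S R `` {v @ w}"
    if "v' \<in> word_cong S R `` {v}" "w' \<in> word_cong S R `` {w}" for v' w'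
    by (rule equiv_class_eq[OF equiv_word_cong, symmetric], rule cong) (use that in simp_all)
  have "word_cong S R `` {v} \<otimes>\<^bsub>presented_group S R\<^esub> word_cong S R `` {w} =
      (\<Union>a\<in>word_cong S R `` {v}. \<Union>b\<in>word_cong S R `` {w}. word_cong S R `` {a @ b})"
    by (simp add: presented_group_def)
  also have "\<dots> = (\<Union>a\<in>word_cong S R `` {v}. \<Union>b\<in>word_cong S R `` {w}. word_cong S R `` {v @ w})"
    by (intro SUP_cong HOL.refl eq)
  also have "\<dots> = word_cong S R `` {v @ w}"
    using word_cong.refl[OF assms(1), of R] word_cong.refl[OF assms(2), of R] by blast
  finally show ?thesis .
qed

lemma word_left_inverse:
  "w \<in> words S \<Longrightarrow> \<exists>w'\<in>words S. (w' @ w, []) \<in> word_cong S R"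
proof (induction w)
  case Nil
  have "[] \<in> words S" by (simp add: words_def)
  then show ?case using word_cong.refl[of "[]" S R] by force
next
  case (Cons a w)
  obtain x b where a: "a = (x, b)" by (cases a)
  from Cons.prems have x: "x \<in> S" and w: "w \<in> words S" by (auto simp: words_def a)
  from Cons.IH[OF w] obtain w' where w': "w' \<in> words S" "(w' @ w, []) \<in> word_cong S R" by blast
  have "((w' @ [(x, \<not> b)]) @ a # w, w' @ w) \<in> word_cong S R"
    using word_cong.cancel[OF w'(1) w x, of "\<not> b" R] by (simp add: a)
  then have "((w' @ [(x, \<not> b)]) @ a # w, []) \<in> word_cong S R"
    using w'(2) by (rule word_cong.trans)
  moreover have "w' @ [(x, \<not> b)] \<in> words S"
    using w'(1) x by (auto simp: words_def)
  ultimately show ?case by blast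
qed

lemma carrier_presented_group:
  "carrier (presented_group S R) = (\<lambda>w. word_cong S R `` {w}) ` words S"
  by (auto simp: presented_group_def quotient_def)

lemma group_presented_group: "group (presented_group S R)"
proof (rule groupI)
  let ?G = "presented_group S R" and ?cl = "\<lambda>w. word_cong S R `` {w}"
  have one: "\<one>\<^bsub>?G\<^esub> = ?cl []"
    by (simp add: presented_group_def)
  have app: "v @ w \<in> words S" if "v \<in> words S" "w \<in> words S" for v w
    using that by (simp add: words_def)
  have Nil: "[] \<in> words S"
    by (simp add: words_def)
  show "\<one>\<^bsub>?G\<^esub> \<in> carrier ?G"
    unfolding carrier_presented_group one by (rule imageI[OF Nil])
  show "A \<otimes>\<^bsub>?G\<^esub> B \<in> carrier ?G" if "A \<in> carrier ?G" "B \<in> carrier ?G" for A B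
  proof -
    from that obtain v w where vw: "v \<in> words S" "A = ?cl v" "w \<in> words S" "B = ?cl w"
      unfolding carrier_presented_group by (elim imageE)
    then have "A \<otimes>\<^bsub>?G\<^esub> B = ?cl (v @ w)"
      by (simp only: presented_mult)
    then show ?thesis
      unfolding carrier_presented_group using app vw(1,3) by blast
  qed
  show "A \<otimes>\<^bsub>?G\<^esub> B \<otimes>\<^bsub>?G\<^esub> D = A \<otimes>\<^bsub>?G\<^esub> (B \<otimes>\<^bsub>?G\<^esub> D)"
    if "A \<in> carrier ?G" "B \<in> carrier ?G" "D \<in> carrier ?G" for A B D
  proof -
    from that obtain u v w where
      "u \<in> words S" "A = ?cl u" "v \<in> words S" "B = ?cl v" "w \<in> words S" "D = ?cl w"
      unfolding carrier_presented_group by (elim imageE)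
    then show ?thesis
      by (simp only: presented_mult app append_assoc)
  qed
  show "\<one>\<^bsub>?G\<^esub> \<otimes>\<^bsub>?G\<^esub> A = A" if "A \<in> carrier ?G" for A
  proof -
    from that obtain w where "w \<in> words S" "A = ?cl w"
      unfolding carrier_presented_group by (elim imageE)
    then show ?thesis
      by (simp only: one presented_mult Nil append_Nil)
  qed
  show "\<exists>B\<in>carrier ?G. B \<otimes>\<^bsub>?G\<^esub> A = \<one>\<^bsub>?G\<^esub>" if "A \<in> carrier ?G" for A
  proof -
    from that obtain w where w: "w \<in> words S" "A = ?cl w"
      unfolding carrier_presented_group by (elim imageE)
    obtain w' where w': "w' \<in> words S" "(w' @ w, []) \<in> word_cong S R"
      using word_left_inverse[OF w(1)] by blast
    have "?cl w' \<otimes>\<^bsub>?G\<^esub> A = \<one>\<^bsub>?G\<^esub>"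
      using w w' by (simp only: presented_mult one equiv_class_eq[OF equiv_word_cong])
    moreover have "?cl w' \<in> carrier ?G"
      unfolding carrier_presented_group by (rule imageI[OF w'(1)])
    ultimately show ?thesis by blast
  qed
qed


section \<open>The braid group of type D\<close>

datatype brD_letter = Sigma nat | Tau

definition brD_letters :: "nat \<Rightarrow> brD_letter set" where
  "brD_letters n = insert Tau (Sigma ` {1..n - 1})"

definition brD_relations :: "nat \<Rightarrow> (brD_letter word \<times> brD_letter word) set" where
  "brD_relations n =
    (let s = (\<lambda>i. (Sigma i, True)); t = (Tau, True) in
       {([s i, s (i + 1), s i], [s (i + 1), s i, s (i + 1)]) | i. 1 \<le> i \<and> i + 2 \<le> n} \<union>
       {([s i, s j], [s j, s i]) | i j. i \<in> {1..n - 1} \<and> j \<in> {1..n - 1} \<and> \<bar>int i - int j\<bar> \<ge> 2} \<union>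
       {([s i, t], [t, s i]) | i. 1 \<le> i \<and> (i + 3 \<le> n \<or> i + 1 = n)} \<union>
       (if n \<ge> 3 then {([s (n - 2), t, s (n - 2)], [t, s (n - 2), t])} else {}))"

definition BrD :: "nat \<Rightarrow> brD_letter word set monoid" where
  "BrD n = presented_group (brD_letters n) (brD_relations n)"

definition BrD_sigma :: "nat \<Rightarrow> nat \<Rightarrow> brD_letter word set" where
  "BrD_sigma n i = presented_gen (brD_letters n) (brD_relations n) (Sigma i)"

definition BrD_t :: "nat \<Rightarrow> brD_letter word set" where
  "BrD_t n = presented_gen (brD_letters n) (brD_relations n) Tau"


section \<open>The images of the generators\<close>

text \<open>The arrows attached to \<open>\<sigma>\<^sub>i\<close> and \<open>t\<close> on \<open>V\<^bsup>\<otimes>n\<^esup> \<triangleright> N\<close>. All the tensor products that the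
  usual notation writes between an arrow of \<open>C\<close> and an arrow of \<open>M\<close> are actions.\<close>

definition sigma_arrow ::
  "('co, 'cm, 'k, 'z) braided_cat_scheme \<Rightarrow> ('o, 'm, 'k, 'co, 'cm, 'w) braided_mod_cat_scheme \<Rightarrow>
    'co \<Rightarrow> 'o \<Rightarrow> nat \<Rightarrow> nat \<Rightarrow> 'm"
  where
  "sigma_arrow C M V N n i =
     ident C (tensor_pow C V (i - 1)) \<triangleright>\<^sub>a\<^bsub>M\<^esub>
       (braiding C V V \<triangleright>\<^sub>a\<^bsub>M\<^esub> ident M (tensor_pow C V (n - i - 1) \<triangleright>\<^sub>o\<^bsub>M\<^esub> N))"

definition t_arrow ::
  "('co, 'cm, 'k, 'z) braided_cat_scheme \<Rightarrow> ('o, 'm, 'k, 'co, 'cm, 'w) braided_mod_cat_scheme \<Rightarrow>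
    'co \<Rightarrow> 'o \<Rightarrow> nat \<Rightarrow> 'm"
  where
  "t_arrow C M V N n =
     ident C (tensor_pow C V (n - 2)) \<triangleright>\<^sub>a\<^bsub>M\<^esub>
       ((ident C V \<triangleright>\<^sub>a\<^bsub>M\<^esub> mod_braiding M V N) \<bullet>\<^bsub>M\<^esub>
        (braiding C V V \<triangleright>\<^sub>a\<^bsub>M\<^esub> ident M N) \<bullet>\<^bsub>M\<^esub>
        (ident C V \<triangleright>\<^sub>a\<^bsub>M\<^esub> mod_braiding M V N))"

end

theory Submission
  imports Defs
begin

text \<open>Let \<open>\<tau>\<close> be \<open>e\<^bsub>X,M\<^esub>\<close> acting on the last strand. The symmetry of the module category makes it an
  involution, and \<open>t = \<tau> \<sigma>\<^sub>n\<^sub>-\<^sub>1 \<tau>\<close>. Naturality of \<open>e\<close> and its compatibility with the action give the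
  type B relation \<open>\<tau> \<sigma>\<^sub>n\<^sub>-\<^sub>1 \<tau> \<sigma>\<^sub>n\<^sub>-\<^sub>1 = \<sigma>\<^sub>n\<^sub>-\<^sub>1 \<tau> \<sigma>\<^sub>n\<^sub>-\<^sub>1 \<tau>\<close>, and \<open>\<tau>\<close> commutes with the other
  \<open>\<sigma>\<^sub>i\<close>. The relations of type D follow by the usual computation that embeds the Artin group of type D
  in the quotient of that of type B by \<open>\<tau>\<^sup>2 = 1\<close>.\<close>

section \<open>Homomorphisms out of presented groups\<close>

definition word_eval :: "('a, 'b) monoid_scheme \<Rightarrow> ('g \<Rightarrow> 'a) \<Rightarrow> 'g word \<Rightarrow> 'a" where
  "word_eval G f w =
     foldr (\<lambda>(x, b) g. (if b then f x else inv\<^bsub>G\<^esub> f x) \<otimes>\<^bsub>G\<^esub> g) w \<one>\<^bsub>G\<^esub>"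

lemma word_eval_Nil [simp]: "word_eval G f [] = \<one>\<^bsub>G\<^esub>"
  by (simp add: word_eval_def)

lemma word_eval_Cons [simp]:
  "word_eval G f ((x, b) # w) = (if b then f x else inv\<^bsub>G\<^esub> f x) \<otimes>\<^bsub>G\<^esub> word_eval G f w"
  by (simp add: word_eval_def)

lemma words_Cons: "(x, b) # w \<in> words S \<longleftrightarrow> x \<in> S \<and> w \<in> words S"
  by (auto simp: words_def)

lemma words_Nil: "[] \<in> words S"
  by (simp add: words_def)

lemma words_append: "v @ w \<in> words S \<longleftrightarrow> v \<in> words S \<and> w \<in> words S"
  by (auto simp: words_def)

context group
begin

lemma word_eval_closed:
  assumes "f \<in> S \<rightarrow> carrier G" "w \<in> words S"
  shows "word_eval G f w \<in> carrier G"
  using assms(2)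
proof (induction w)
  case (Cons a w)
  then show ?case
    using assms(1) by (cases a) (auto simp: words_Cons)
qed simp

lemma word_eval_append:
  assumes "f \<in> S \<rightarrow> carrier G" "v \<in> words S" "w \<in> words S"
  shows "word_eval G f (v @ w) = word_eval G f v \<otimes> word_eval G f w"
  using assms(2)
proof (induction v)
  case Nil
  then show ?case using word_eval_closed[OF assms(1,3)] by simp
next
  case (Cons a v)
  obtain x b where a: "a = (x, b)" by (cases a)
  from Cons.prems have "x \<in> S" "v \<in> words S" by (simp_all add: a words_Cons)
  moreover have "f x \<in> carrier G" using \<open>x \<in> S\<close> assms(1) by blast
  ultimately show ?case
    using Cons.IH word_eval_closed[OF assms(1)] assms(3) by (auto simp: a m_assoc)
qed

text \<open>Induction on the generation of the congruence. Evaluation is multiplicative, so the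
  context \<open>u\<close>, \<open>v\<close> factors off and only a cancelling pair or the two sides
  of a relation remain to be compared.\<close>

lemma word_eval_cong:
  assumes f: "f \<in> S \<rightarrow> carrier G"
    and rel: "\<And>l r. (l, r) \<in> R \<Longrightarrow> word_eval G f l = word_eval G f r"
    and "(v, w) \<in> word_cong S R"
  shows "word_eval G f v = word_eval G f w"
  using assms(3)
proof (induction rule: word_cong.induct)
  case (cancel u v x b)
  have "f x \<in> carrier G" using f cancel by blast
  then have "word_eval G f ([(x, b), (x, \<not> b)] @ v) = word_eval G f v"
    using word_eval_closed[OF f cancel(2)] by (cases b) (simp_all flip: m_assoc)
  then show ?case
    using cancel by (simp add: word_eval_append[OF f] words_Cons)
next
  case (relation u v l r)
  then show ?case
    using rel by (simp add: word_eval_append[OF f] words_append)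
qed auto

text \<open>Von Dyck's theorem. HOL functions are total, so \<open>extensional\<close> fixes the
  values off the carrier and lets uniqueness be an equality of functions.\<close>

theorem presented_group_universal:
  assumes f: "f \<in> S \<rightarrow> carrier G"
    and rel: "\<And>l r. (l, r) \<in> R \<Longrightarrow> word_eval G f l = word_eval G f r"
  shows "\<exists>!\<rho>. \<rho> \<in> extensional (carrier (presented_group S R)) \<and>
    group_hom (presented_group S R) G \<rho> \<and> (\<forall>x\<in>S. \<rho> (presented_gen S R x) = f x)"
proof -
  let ?P = "presented_group S R" and ?cl = "\<lambda>w. word_cong S R `` {w}"
  interpret P: group ?P by (rule group_presented_group)
  note eval_closed = word_eval_closed[OF f]
  \<comment> \<open>\<open>SOME\<close> picks a representative word of each class;
    \<open>word_eval_cong\<close> makes the choice irrelevant.\<close>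
  define \<rho> where "\<rho> = (\<lambda>A\<in>carrier ?P. word_eval G f (SOME w. w \<in> A))"
  have \<rho>: "\<rho> (?cl w) = word_eval G f w" if w: "w \<in> words S" for w
  proof -
    have "(SOME v. v \<in> ?cl w) \<in> ?cl w"
      by (rule someI[of _ w]) (simp add: word_cong.refl w)
    then have "word_eval G f w = word_eval G f (SOME v. v \<in> ?cl w)"
      by (intro word_eval_cong[OF f rel]) auto
    then show ?thesis
      using w by (simp add: \<rho>_def carrier_presented_group)
  qed
  have "\<rho> \<in> hom ?P G"
  proof (rule homI)
    fix A assume "A \<in> carrier ?P"
    then show "\<rho> A \<in> carrier G"
      unfolding carrier_presented_group by (elim imageE) (simp add: \<rho> eval_closed)
  next
    fix A B assume "A \<in> carrier ?P" "B \<in> carrier ?P"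
    then obtain v w where "v \<in> words S" "A = ?cl v" "w \<in> words S" "B = ?cl w"
      unfolding carrier_presented_group by (elim imageE)
    then show "\<rho> (A \<otimes>\<^bsub>?P\<^esub> B) = \<rho> A \<otimes> \<rho> B"
      by (simp add: presented_mult \<rho> word_eval_append[OF f] words_append)
  qed
  then have hom: "group_hom ?P G \<rho>"
    by unfold_locales
  have gen: "\<rho> (presented_gen S R x) = f x" if "x \<in> S" for x
  proof -
    have "f x \<in> carrier G" using f that by blast
    with that show ?thesis
      by (simp add: presented_gen_def \<rho> words_Cons words_Nil)
  qed
  have unique: "\<rho>' = \<rho>"
    if ext: "\<rho>' \<in> extensional (carrier ?P)" and "group_hom ?P G \<rho>'"
      and gen': "\<forall>x\<in>S. \<rho>' (presented_gen S R x) = f x" for \<rho>'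
  proof -
    interpret \<rho>': group_hom ?P G \<rho>' by fact
    have in_carrier: "?cl w \<in> carrier ?P" if "w \<in> words S" for w
      using that by (simp add: carrier_presented_group)
    have \<rho>'_eval: "\<rho>' (?cl w) = word_eval G f w" if "w \<in> words S" for w
      using that
    proof (induction w)
      case Nil
      have "?cl [] = \<one>\<^bsub>?P\<^esub>" by (simp add: presented_group_def)
      then show ?case using \<rho>'.hom_one by simp
    next
      case (Cons a w)
      obtain x b where a: "a = (x, b)" by (cases a)
      from Cons.prems have x: "x \<in> S" and w: "w \<in> words S" by (simp_all add: a words_Cons)
      have letters: "[(x, c)] \<in> words S" for c using x by (simp add: words_Cons words_Nil)
      have pos: "\<rho>' (?cl [(x, True)]) = f x"
        using gen' x by (simp add: presented_gen_def)
      \<comment> \<open>Only positive letters have prescribed images. Cancellation makes the class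
        of a negative letter the inverse of the positive one, so its image is forced as
        well.\<close>
      have "?cl [(x, False)] \<otimes>\<^bsub>?P\<^esub> ?cl [(x, True)] = ?cl ([(x, False)] @ [(x, True)])"
        by (simp only: presented_mult letters)
      also have "\<dots> = \<one>\<^bsub>?P\<^esub>"
        using word_cong.cancel[OF words_Nil words_Nil x, of False R]
        by (simp add: presented_group_def equiv_class_eq[OF equiv_word_cong])
      finally have "?cl [(x, False)] = inv\<^bsub>?P\<^esub> ?cl [(x, True)]"
        using in_carrier letters by (metis P.inv_equality)
      then have neg: "\<rho>' (?cl [(x, False)]) = inv f x"
        using pos in_carrier letters by simp
      have "?cl (a # w) = ?cl [a] \<otimes>\<^bsub>?P\<^esub> ?cl w"
        using letters w by (simp add: a presented_mult)
      then show ?case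
        using Cons.IH[OF w] pos neg in_carrier letters w by (cases b) (simp_all add: a)
    qed
    show ?thesis
    proof (rule extensionalityI[OF ext])
      show "\<rho> \<in> extensional (carrier ?P)" by (simp add: \<rho>_def)
      fix A assume "A \<in> carrier ?P"
      then show "\<rho>' A = \<rho> A"
        unfolding carrier_presented_group by (elim imageE) (simp add: \<rho> \<rho>'_eval)
    qed
  qed
  show ?thesis
    using hom gen unique by (intro ex1I[of _ \<rho>]) (auto simp: \<rho>_def)
qed

end

section \<open>The passage from type B to type D\<close>

context group
begin

text \<open>Up to brackets and the order of the two sides, this is the type B relation
  itself.\<close>

lemma conj_involution_commute:
  assumes "s \<in> carrier G" "\<tau> \<in> carrier G"
    and "\<tau> \<otimes> s \<otimes> \<tau> \<otimes> s = s \<otimes> \<tau> \<otimes> s \<otimes> \<tau>"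
  shows "s \<otimes> (\<tau> \<otimes> s \<otimes> \<tau>) = (\<tau> \<otimes> s \<otimes> \<tau>) \<otimes> s"
  using assms by (simp add: m_assoc)

lemma conj_involution_commute_far:
  assumes "r \<in> carrier G" "s \<in> carrier G" "\<tau> \<in> carrier G"
    and "r \<otimes> s = s \<otimes> r" "r \<otimes> \<tau> = \<tau> \<otimes> r"
  shows "r \<otimes> (\<tau> \<otimes> s \<otimes> \<tau>) = (\<tau> \<otimes> s \<otimes> \<tau>) \<otimes> r"
  using assms by (metis m_assoc m_closed)

text \<open>Conjugation by \<tau> is an automorphism that fixes \<open>r\<close>, so it carries the
  braid relation of \<open>r\<close> and \<open>s\<close> to that of \<open>r\<close> and the
  conjugate of \<open>s\<close>.\<close>

lemma conj_involution_braid: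
  assumes [simp]: "r \<in> carrier G" "s \<in> carrier G" "\<tau> \<in> carrier G"
    and "\<tau> \<otimes> \<tau> = \<one>" "r \<otimes> \<tau> = \<tau> \<otimes> r" "r \<otimes> s \<otimes> r = s \<otimes> r \<otimes> s"
  shows "r \<otimes> (\<tau> \<otimes> s \<otimes> \<tau>) \<otimes> r = (\<tau> \<otimes> s \<otimes> \<tau>) \<otimes> r \<otimes> (\<tau> \<otimes> s \<otimes> \<tau>)"
proof -
  have "r \<otimes> (\<tau> \<otimes> s \<otimes> \<tau>) \<otimes> r = (r \<otimes> \<tau>) \<otimes> s \<otimes> (\<tau> \<otimes> r)"
    by (simp add: m_assoc)
  also have "\<dots> = \<tau> \<otimes> (r \<otimes> s \<otimes> r) \<otimes> \<tau>"
    unfolding assms(5)[symmetric] by (simp add: assms(5) m_assoc)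
  \<comment> \<open>The square of \<tau> is inserted before \<open>r\<close>; next, one of the two
    factors moves past \<open>r\<close> to complete the second conjugate.\<close>
  also have "\<dots> = \<tau> \<otimes> s \<otimes> (\<tau> \<otimes> \<tau> \<otimes> r) \<otimes> s \<otimes> \<tau>"
    by (simp add: assms(4,6) m_assoc)
  also have "\<tau> \<otimes> \<tau> \<otimes> r = \<tau> \<otimes> r \<otimes> \<tau>"
    by (simp add: assms(5) m_assoc)
  finally show ?thesis
    by (simp add: m_assoc)
qed

end

section \<open>Isomorphisms and whiskering\<close>

context linear_category
begin

lemma iso_arrow_hom: "iso_arrow C V Y f \<Longrightarrow> f \<in> hom_set C V Y"
  by (auto simp: iso_arrow_def inverse_arrows_def)

lemma iso_arrow_ident: "V \<in> Obj C \<Longrightarrow> iso_arrow C V V (ident C V)"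
  unfolding iso_arrow_def inverse_arrows_def using ident_in_hom comp_ident_left by blast

text \<open>The definite description is proper because two inverses \<open>g\<close> and
  \<open>h\<close> of \<open>f\<close> both equal the composite of \<open>h\<close>,
  \<open>f\<close> and \<open>g\<close>.\<close>

lemma inverse_arrows_inv_arrow:
  assumes "V \<in> Obj C" "Y \<in> Obj C" "iso_arrow C V Y f"
  shows "inverse_arrows C V Y f (inv_arrow C V Y f)"
proof -
  obtain g where g: "inverse_arrows C V Y f g"
    using assms by (auto simp: iso_arrow_def)
  have "h = g" if h: "inverse_arrows C V Y f h" for h
  proof -
    have "h = h \<bullet>\<^bsub>C\<^esub> (f \<bullet>\<^bsub>C\<^esub> g)"
      using g h assms comp_ident_right by (simp add: inverse_arrows_def)
    also have "\<dots> = (h \<bullet>\<^bsub>C\<^esub> f) \<bullet>\<^bsub>C\<^esub> g"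
      using g h assms comp_assoc[of Y V Y V g f h] by (simp add: inverse_arrows_def)
    also have "\<dots> = g"
      using g h assms comp_ident_left by (simp add: inverse_arrows_def)
    finally show ?thesis .
  qed
  then show ?thesis
    unfolding inv_arrow_def using g by (metis theI)
qed

lemma carrier_Aut_group: "f \<in> carrier (Aut_group C V) \<longleftrightarrow> iso_arrow C V V f"
  by (auto simp: Aut_group_def units_of_def End_monoid_def Units_def iso_arrow_def inverse_arrows_def)

lemma mult_Aut_group: "f \<otimes>\<^bsub>Aut_group C V\<^esub> g = f \<bullet>\<^bsub>C\<^esub> g"
  by (simp add: Aut_group_def units_of_def End_monoid_def)

lemma one_Aut_group: "\<one>\<^bsub>Aut_group C V\<^esub> = ident C V"
  by (simp add: Aut_group_def units_of_def End_monoid_def)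

end

lemma (in bilinear_bifunctor) map_iso:
  assumes "V \<in> Obj A" "V' \<in> Obj A" "Y \<in> Obj B" "Y' \<in> Obj B"
    and "iso_arrow A V V' f" "iso_arrow B Y Y' g"
  shows "iso_arrow D (Fo V Y) (Fo V' Y') (Fa f g)"
proof -
  obtain f' g' where "inverse_arrows A V V' f f'" "inverse_arrows B Y Y' g g'"
    using assms(5,6) by (auto simp: iso_arrow_def)
  then have "inverse_arrows D (Fo V Y) (Fo V' Y') (Fa f g) (Fa f' g')"
    using assms(1-4) by (auto simp: inverse_arrows_def map_hom map_ident simp flip: map_comp)
  then show ?thesis
    by (auto simp: iso_arrow_def)
qed

context strict_monoidal_category
begin

lemma tensor_pow_Obj [simp]: "V \<in> Obj C \<Longrightarrow> tensor_pow C V n \<in> Obj C"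
  by (induction n) (simp_all add: unit_in_Obj map_obj)

lemma tensor_pow_add:
  "V \<in> Obj C \<Longrightarrow> tensor_pow C V (a + b) = tensor_pow C V a \<otimes>\<^sub>o\<^bsub>C\<^esub> tensor_pow C V b"
  by (induction a) (simp_all add: tensor_obj_unit_left tensor_obj_assoc)

end

section \<open>The local relations in a module category\<close>

context strict_module_category
begin

text \<open>In string diagrams, \<open>k\<close> untouched strands to the left of \<open>f\<close>.
  Every generator is brought to this form, so that relations can be checked with the common left
  strands removed.\<close>

definition whisker :: "'co \<Rightarrow> nat \<Rightarrow> 'm \<Rightarrow> 'm" where
  "whisker V k f = ident C (tensor_pow C V k) \<triangleright>\<^sub>a\<^bsub>M\<^esub> f"

lemma act_pow_add:
  "\<lbrakk>V \<in> Obj C; N \<in> Obj M\<rbrakk>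
    \<Longrightarrow> tensor_pow C V (a + b) \<triangleright>\<^sub>o\<^bsub>M\<^esub> N = tensor_pow C V a \<triangleright>\<^sub>o\<^bsub>M\<^esub> (tensor_pow C V b \<triangleright>\<^sub>o\<^bsub>M\<^esub> N)"
  by (simp add: C.tensor_pow_add act_obj_assoc)

lemma ident_act_comp:
  assumes "V \<in> Obj C" "N \<in> Obj M" "N' \<in> Obj M" "N'' \<in> Obj M"
    and "f \<in> hom_set M N N'" "g \<in> hom_set M N' N''"
  shows "ident C V \<triangleright>\<^sub>a\<^bsub>M\<^esub> (g \<bullet>\<^bsub>M\<^esub> f) = (ident C V \<triangleright>\<^sub>a\<^bsub>M\<^esub> g) \<bullet>\<^bsub>M\<^esub> (ident C V \<triangleright>\<^sub>a\<^bsub>M\<^esub> f)"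
  using map_comp[OF assms(1,1,1,2,3,4) C.A.ident_in_hom C.A.ident_in_hom assms(5,6)] assms(1)
  by (simp add: C.A.comp_ident_left C.A.ident_in_hom)

lemma act_ident_comp:
  assumes "V \<in> Obj C" "V' \<in> Obj C" "V'' \<in> Obj C" "N \<in> Obj M"
    and "f \<in> hom_set C V V'" "g \<in> hom_set C V' V''"
  shows "(g \<bullet>\<^bsub>C\<^esub> f) \<triangleright>\<^sub>a\<^bsub>M\<^esub> ident M N = (g \<triangleright>\<^sub>a\<^bsub>M\<^esub> ident M N) \<bullet>\<^bsub>M\<^esub> (f \<triangleright>\<^sub>a\<^bsub>M\<^esub> ident M N)"
  using map_comp[OF assms(1,2,3,4,4,4,5,6) B.ident_in_hom B.ident_in_hom] assms(4)
  by (simp add: B.comp_ident_left B.ident_in_hom)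

text \<open>By bifunctoriality, both composites equal the action of \<open>f\<close> on
  \<open>h\<close>.\<close>

lemma interchange:
  assumes "V \<in> Obj C" "V' \<in> Obj C" "N \<in> Obj M" "N' \<in> Obj M"
    and "f \<in> hom_set C V V'" "h \<in> hom_set M N N'"
  shows "(f \<triangleright>\<^sub>a\<^bsub>M\<^esub> ident M N') \<bullet>\<^bsub>M\<^esub> (ident C V \<triangleright>\<^sub>a\<^bsub>M\<^esub> h) =
    (ident C V' \<triangleright>\<^sub>a\<^bsub>M\<^esub> h) \<bullet>\<^bsub>M\<^esub> (f \<triangleright>\<^sub>a\<^bsub>M\<^esub> ident M N)"
proof -
  have "(f \<triangleright>\<^sub>a\<^bsub>M\<^esub> ident M N') \<bullet>\<^bsub>M\<^esub> (ident C V \<triangleright>\<^sub>a\<^bsub>M\<^esub> h) =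
      (f \<bullet>\<^bsub>C\<^esub> ident C V) \<triangleright>\<^sub>a\<^bsub>M\<^esub> (ident M N' \<bullet>\<^bsub>M\<^esub> h)"
    using assms by (simp add: map_comp C.A.ident_in_hom B.ident_in_hom)
  also have "\<dots> = (ident C V' \<bullet>\<^bsub>C\<^esub> f) \<triangleright>\<^sub>a\<^bsub>M\<^esub> (h \<bullet>\<^bsub>M\<^esub> ident M N)"
    using assms
    by (simp add: C.A.comp_ident_left C.A.comp_ident_right B.comp_ident_left B.comp_ident_right)
  also have "\<dots> = (ident C V' \<triangleright>\<^sub>a\<^bsub>M\<^esub> h) \<bullet>\<^bsub>M\<^esub> (f \<triangleright>\<^sub>a\<^bsub>M\<^esub> ident M N)"
    using assms by (simp add: map_comp C.A.ident_in_hom B.ident_in_hom)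
  finally show ?thesis .
qed

lemma whisker_comp:
  assumes "V \<in> Obj C" "N \<in> Obj M" "f \<in> hom_set M N N" "g \<in> hom_set M N N"
  shows "whisker V k (g \<bullet>\<^bsub>M\<^esub> f) = whisker V k g \<bullet>\<^bsub>M\<^esub> whisker V k f"
  unfolding whisker_def using assms by (simp add: ident_act_comp)

lemma whisker_ident:
  assumes "V \<in> Obj C" "N \<in> Obj M"
  shows "whisker V k (ident M N) = ident M (tensor_pow C V k \<triangleright>\<^sub>o\<^bsub>M\<^esub> N)"
  unfolding whisker_def using assms by (simp add: map_ident)

lemma whisker_iso:
  assumes "V \<in> Obj C" "N \<in> Obj M" "iso_arrow M N N f"
  shows "iso_arrow M (tensor_pow C V k \<triangleright>\<^sub>o\<^bsub>M\<^esub> N) (tensor_pow C V k \<triangleright>\<^sub>o\<^bsub>M\<^esub> N) (whisker V k f)"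
  unfolding whisker_def using assms by (simp add: map_iso C.A.iso_arrow_ident)

text \<open>Strictness turns regrouping of strands into an equality of arrows; this is what allows
  generators at different depths to be compared.\<close>

lemma whisker_add:
  assumes "V \<in> Obj C" "N \<in> Obj M" "f \<in> hom_set M N N"
  shows "whisker V (a + b) f = whisker V a (whisker V b f)"
proof -
  have "ident C (tensor_pow C V (a + b)) =
      ident C (tensor_pow C V a) \<otimes>\<^sub>a\<^bsub>C\<^esub> ident C (tensor_pow C V b)"
    using assms(1) by (simp add: C.tensor_pow_add C.map_ident)
  then show ?thesis
    unfolding whisker_def
    using act_arr_assoc[OF _ _ _ _ assms(2,2) C.A.ident_in_hom C.A.ident_in_hom assms(3)] assms(1)
    by simp
qed

end

section \<open>Crossings of two adjacent strands and the module braiding\<close>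

context braided_module_category
begin

text \<open>The object \<open>P\<close> absorbs everything to the right of the two crossing
  strands.\<close>

definition crossing :: "'co \<Rightarrow> 'o \<Rightarrow> 'm" where
  "crossing V P = braiding C V V \<triangleright>\<^sub>a\<^bsub>M\<^esub> ident M P"

lemma crossing_iso:
  assumes "V \<in> Obj C" "P \<in> Obj M"
  shows "iso_arrow M (V \<triangleright>\<^sub>o\<^bsub>M\<^esub> V \<triangleright>\<^sub>o\<^bsub>M\<^esub> P) (V \<triangleright>\<^sub>o\<^bsub>M\<^esub> V \<triangleright>\<^sub>o\<^bsub>M\<^esub> P) (crossing V P)"
  using map_iso[OF C.map_obj C.map_obj assms(2,2) C.braiding_iso B.iso_arrow_ident] assms
  by (simp add: crossing_def act_obj_assoc)

text \<open>The two identity strands merge into the identity of the tensor square of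
  \<open>V\<close>, and the interchange law applies.\<close>

lemma crossing_interchange:
  assumes "V \<in> Obj C" "P \<in> Obj M" "h \<in> hom_set M P P"
  shows "crossing V P \<bullet>\<^bsub>M\<^esub> (ident C V \<triangleright>\<^sub>a\<^bsub>M\<^esub> (ident C V \<triangleright>\<^sub>a\<^bsub>M\<^esub> h)) =
    (ident C V \<triangleright>\<^sub>a\<^bsub>M\<^esub> (ident C V \<triangleright>\<^sub>a\<^bsub>M\<^esub> h)) \<bullet>\<^bsub>M\<^esub> crossing V P"
proof -
  have "ident C V \<triangleright>\<^sub>a\<^bsub>M\<^esub> (ident C V \<triangleright>\<^sub>a\<^bsub>M\<^esub> h) = ident C (V \<otimes>\<^sub>o\<^bsub>C\<^esub> V) \<triangleright>\<^sub>a\<^bsub>M\<^esub> h"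
    using act_arr_assoc[OF assms(1,1,1,1,2,2) C.A.ident_in_hom C.A.ident_in_hom assms(3)] assms(1)
    by (simp add: C.map_ident)
  moreover have "braiding C V V \<in> hom_set C (V \<otimes>\<^sub>o\<^bsub>C\<^esub> V) (V \<otimes>\<^sub>o\<^bsub>C\<^esub> V)"
    using assms(1) C.braiding_iso C.A.iso_arrow_hom by blast
  ultimately show ?thesis
    unfolding crossing_def using assms by (simp add: interchange C.map_obj)
qed

text \<open>The Yang-Baxter equation in \<open>C\<close>, transported by the functor that acts on
  \<open>P\<close>.\<close>

lemma crossing_braid:
  assumes V: "V \<in> Obj C" and P: "P \<in> Obj M"
  shows "crossing V (V \<triangleright>\<^sub>o\<^bsub>M\<^esub> P) \<bullet>\<^bsub>M\<^esub> (ident C V \<triangleright>\<^sub>a\<^bsub>M\<^esub> crossing V P) \<bullet>\<^bsub>M\<^esub> crossing V (V \<triangleright>\<^sub>o\<^bsub>M\<^esub> P) =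
    (ident C V \<triangleright>\<^sub>a\<^bsub>M\<^esub> crossing V P) \<bullet>\<^bsub>M\<^esub> crossing V (V \<triangleright>\<^sub>o\<^bsub>M\<^esub> P) \<bullet>\<^bsub>M\<^esub> (ident C V \<triangleright>\<^sub>a\<^bsub>M\<^esub> crossing V P)"
proof -
  let ?c = "braiding C V V" and ?VV = "V \<otimes>\<^sub>o\<^bsub>C\<^esub> V" and ?VVV = "V \<otimes>\<^sub>o\<^bsub>C\<^esub> V \<otimes>\<^sub>o\<^bsub>C\<^esub> V"
  let ?l = "?c \<otimes>\<^sub>a\<^bsub>C\<^esub> ident C V" and ?r = "ident C V \<otimes>\<^sub>a\<^bsub>C\<^esub> ?c"
  have VV: "?VV \<in> Obj C" and VVV: "?VVV \<in> Obj C"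
    using V by (simp_all add: C.map_obj)
  have c: "?c \<in> hom_set C ?VV ?VV"
    using V C.braiding_iso C.A.iso_arrow_hom by blast
  have l: "?l \<in> hom_set C ?VVV ?VVV"
    using C.map_hom[OF VV VV V V c C.A.ident_in_hom[OF V]] V by (simp add: C.tensor_obj_assoc)
  have r: "?r \<in> hom_set C ?VVV ?VVV"
    using C.map_hom[OF V V VV VV C.A.ident_in_hom[OF V] c] .
  \<comment> \<open>Naturality of the braiding of \<open>V\<close> with its tensor square, applied
    to the crossing in that square. The hexagon identity splits this braiding into \<open>?l\<close>
    followed by \<open>?r\<close>.\<close>
  have "braiding C V ?VV \<bullet>\<^bsub>C\<^esub> ?r = ?l \<bullet>\<^bsub>C\<^esub> braiding C V ?VV"
    using C.braiding_natural[OF V V VV VV C.A.ident_in_hom[OF V] c] .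
  then have yang_baxter: "?l \<bullet>\<^bsub>C\<^esub> ?r \<bullet>\<^bsub>C\<^esub> ?l = ?r \<bullet>\<^bsub>C\<^esub> ?l \<bullet>\<^bsub>C\<^esub> ?r"
    using C.A.comp_assoc[OF VVV VVV VVV VVV r l r] by (simp add: C.braiding_tensor_right V)
  have l_act: "crossing V (V \<triangleright>\<^sub>o\<^bsub>M\<^esub> P) = ?l \<triangleright>\<^sub>a\<^bsub>M\<^esub> ident M P"
    using act_arr_assoc[OF VV VV V V P P c C.A.ident_in_hom[OF V] B.ident_in_hom[OF P]] V P
    by (simp add: crossing_def map_ident)
  have r_act: "ident C V \<triangleright>\<^sub>a\<^bsub>M\<^esub> crossing V P = ?r \<triangleright>\<^sub>a\<^bsub>M\<^esub> ident M P"
    using act_arr_assoc[OF V V VV VV P P C.A.ident_in_hom[OF V] c B.ident_in_hom[OF P]]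
    by (simp add: crossing_def)
  have comp: "(f \<triangleright>\<^sub>a\<^bsub>M\<^esub> ident M P) \<bullet>\<^bsub>M\<^esub> (g \<triangleright>\<^sub>a\<^bsub>M\<^esub> ident M P) \<bullet>\<^bsub>M\<^esub> (h \<triangleright>\<^sub>a\<^bsub>M\<^esub> ident M P) =
      (f \<bullet>\<^bsub>C\<^esub> g \<bullet>\<^bsub>C\<^esub> h) \<triangleright>\<^sub>a\<^bsub>M\<^esub> ident M P"
    if "f \<in> hom_set C ?VVV ?VVV" "g \<in> hom_set C ?VVV ?VVV" "h \<in> hom_set C ?VVV ?VVV" for f g h
    using that VVV P C.A.comp_in_hom[OF VVV VVV VVV that(3,2)]
    by (simp add: act_ident_comp[of ?VVV ?VVV ?VVV])
  show ?thesis
    unfolding l_act r_act using l r by (simp add: comp yang_baxter)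
qed

text \<open>Compatibility with the action identifies \<open>\<sigma> \<tau> \<sigma>\<close> with \<open>e\<^bsub>V,V\<triangleright>P\<^esub>\<close>, which commutes with \<open>\<tau>\<close> by
  naturality.\<close>

lemma crossing_mod_braiding:
  assumes V: "V \<in> Obj C" and P: "P \<in> Obj M"
  defines "s \<equiv> crossing V P" and "\<tau> \<equiv> ident C V \<triangleright>\<^sub>a\<^bsub>M\<^esub> mod_braiding M V P"
  shows "\<tau> \<bullet>\<^bsub>M\<^esub> s \<bullet>\<^bsub>M\<^esub> \<tau> \<bullet>\<^bsub>M\<^esub> s = s \<bullet>\<^bsub>M\<^esub> \<tau> \<bullet>\<^bsub>M\<^esub> s \<bullet>\<^bsub>M\<^esub> \<tau>"
proof -
  let ?Q = "V \<triangleright>\<^sub>o\<^bsub>M\<^esub> V \<triangleright>\<^sub>o\<^bsub>M\<^esub> P"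
  have VP: "V \<triangleright>\<^sub>o\<^bsub>M\<^esub> P \<in> Obj M" and Q: "?Q \<in> Obj M"
    using V P by (simp_all add: map_obj)
  have e: "mod_braiding M V P \<in> hom_set M (V \<triangleright>\<^sub>o\<^bsub>M\<^esub> P) (V \<triangleright>\<^sub>o\<^bsub>M\<^esub> P)"
    using mod_braiding_iso[OF V P] by (rule B.iso_arrow_hom)
  have \<tau>: "\<tau> \<in> hom_set M ?Q ?Q"
    unfolding \<tau>_def using map_hom[OF V V VP VP C.A.ident_in_hom[OF V] e] .
  have s: "s \<in> hom_set M ?Q ?Q"
    unfolding s_def using crossing_iso[OF V P] by (rule B.iso_arrow_hom)
  have "mod_braiding M V (V \<triangleright>\<^sub>o\<^bsub>M\<^esub> P) = s \<bullet>\<^bsub>M\<^esub> \<tau> \<bullet>\<^bsub>M\<^esub> s"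
    using mod_braiding_act[OF V V P] by (simp add: s_def \<tau>_def crossing_def)
  moreover have "mod_braiding M V (V \<triangleright>\<^sub>o\<^bsub>M\<^esub> P) \<bullet>\<^bsub>M\<^esub> \<tau> = \<tau> \<bullet>\<^bsub>M\<^esub> mod_braiding M V (V \<triangleright>\<^sub>o\<^bsub>M\<^esub> P)"
    unfolding \<tau>_def by (rule mod_braiding_natural[OF V V VP VP C.A.ident_in_hom[OF V] e])
  ultimately show ?thesis
    using Q s \<tau> by (simp add: B.comp_assoc[of ?Q ?Q ?Q ?Q] B.comp_in_hom[of ?Q ?Q ?Q])
qed

end

text \<open>The module braiding equals its own inverse, so the inverse law says that its square is
  the identity.\<close>

lemma (in symmetric_module_category) mod_braiding_involution:
  assumes "V \<in> Obj C" "P \<in> Obj M"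
  shows "mod_braiding M V P \<bullet>\<^bsub>M\<^esub> mod_braiding M V P = ident M (V \<triangleright>\<^sub>o\<^bsub>M\<^esub> P)"
  using B.inverse_arrows_inv_arrow[OF _ _ mod_braiding_iso[OF assms]] assms
  by (simp add: map_obj inverse_arrows_def flip: mod_braiding_self_inverse)

section \<open>The relations on \<open>V\<^bsup>\<otimes>n\<^esup> \<triangleright> N\<close>\<close>

text \<open>The objects usually written X and M are \<open>V\<close> and \<open>N\<close> here,
  while \<open>M\<close> is the module category.\<close>

locale type_D_action = symmetric_module_category K C M
  for K :: "('k, 'y) ring_scheme" and C :: "('co, 'cm, 'k, 'z) braided_cat_scheme"
    and M :: "('o, 'm, 'k, 'co, 'cm, 'w) braided_mod_cat_scheme" +
  fixes V :: 'co and N :: 'o and n :: nat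
  assumes V: "V \<in> Obj C" and N: "N \<in> Obj M" and n: "n \<ge> 2"
begin

abbreviation strands :: "nat \<Rightarrow> 'o" where
  "strands k \<equiv> tensor_pow C V k \<triangleright>\<^sub>o\<^bsub>M\<^esub> N"

abbreviation G :: "'m monoid" where
  "G \<equiv> Aut_group M (strands n)"

abbreviation \<sigma> :: "nat \<Rightarrow> 'm" where
  "\<sigma> \<equiv> sigma_arrow C M V N n"

abbreviation \<tau> :: 'm where
  "\<tau> \<equiv> whisker V (n - 1) (mod_braiding M V N)"

section \<open>Bookkeeping of strands and the relations of type B\<close>

lemma strands_Obj: "strands k \<in> Obj M"
  using V N by (simp add: map_obj)

lemma strands_Suc: "strands (Suc k) = V \<triangleright>\<^sub>o\<^bsub>M\<^esub> strands k"
  using V N by (simp add: act_obj_assoc)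

lemma strands_add: "strands (a + b) = tensor_pow C V a \<triangleright>\<^sub>o\<^bsub>M\<^esub> strands b"
  using act_pow_add[OF V N] .

lemma strands_1: "strands (Suc 0) = V \<triangleright>\<^sub>o\<^bsub>M\<^esub> N"
  using V N by (simp add: C.tensor_obj_unit_right)

lemma whisker_1: "whisker V (Suc 0) h = ident C V \<triangleright>\<^sub>a\<^bsub>M\<^esub> h"
  using V by (simp add: whisker_def C.tensor_obj_unit_right)

lemma whisker_2:
  assumes "P \<in> Obj M" "h \<in> hom_set M P P"
  shows "whisker V 2 h = ident C V \<triangleright>\<^sub>a\<^bsub>M\<^esub> (ident C V \<triangleright>\<^sub>a\<^bsub>M\<^esub> h)"
  using whisker_add[OF V assms, of "Suc 0" "Suc 0"]
  by (simp add: whisker_1 numeral_2_eq_2)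

lemma sigma_eq: "\<sigma> i = whisker V (i - 1) (crossing V (strands (n - i - 1)))"
  by (simp add: sigma_arrow_def whisker_def crossing_def)

lemma crossing_strands_iso: "iso_arrow M (strands (k + 2)) (strands (k + 2)) (crossing V (strands k))"
  using crossing_iso[OF V strands_Obj] by (simp add: strands_Suc del: tensor_pow.simps)

lemma whisker_strands_iso:
  "iso_arrow M (strands b) (strands b) f \<Longrightarrow> iso_arrow M (strands (a + b)) (strands (a + b)) (whisker V a f)"
  using whisker_iso[OF V strands_Obj] by (simp add: strands_add)

interpretation G: group G
  using strands_Obj by (rule B.group_Aut_group)

lemma sigma_closed:
  assumes "1 \<le> i" "i + 1 \<le> n"
  shows "\<sigma> i \<in> carrier G"
proof -
  \<comment> \<open>The strands to the left, those to the right and the two that cross. The bounds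
    on \<open>i\<close> keep the truncated subtractions exact.\<close>
  have "(i - 1) + ((n - i - 1) + 2) = n" using assms by simp
  then show ?thesis
    using whisker_strands_iso[OF crossing_strands_iso, of "i - 1" "n - i - 1"]
    by (simp only: B.carrier_Aut_group sigma_eq)
qed

lemma mod_braiding_strands_iso: "iso_arrow M (strands (Suc 0)) (strands (Suc 0)) (mod_braiding M V N)"
  unfolding strands_1 using V N by (rule mod_braiding_iso)

lemma tau_closed: "\<tau> \<in> carrier G"
  using whisker_strands_iso[OF mod_braiding_strands_iso, of "n - 1"] n
  by (simp add: B.carrier_Aut_group del: tensor_pow.simps)

text \<open>Whiskering is functorial, so the square may be taken on the last strand alone, where the
  symmetry of the module category applies.\<close>

lemma tau_involution: "\<tau> \<otimes>\<^bsub>G\<^esub> \<tau> = \<one>\<^bsub>G\<^esub>"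
proof -
  have e: "mod_braiding M V N \<in> hom_set M (strands 1) (strands 1)"
    using B.iso_arrow_hom[OF mod_braiding_strands_iso] by simp
  have "n = (n - 1) + 1" using n by simp
  then have "strands n = tensor_pow C V (n - 1) \<triangleright>\<^sub>o\<^bsub>M\<^esub> strands 1" by (metis strands_add)
  then show ?thesis
    using whisker_comp[OF V strands_Obj e e, of "n - 1"] mod_braiding_involution[OF V N]
      whisker_ident[OF V strands_Obj, of "n - 1" 1]
    by (simp add: B.mult_Aut_group B.one_Aut_group strands_1 del: tensor_pow.simps)
qed

text \<open>The crossing uses strands \<open>i\<close> and \<open>i + 1\<close>, while the other
  arrow leaves the first \<open>i + 1\<close> strands untouched. This serves both for distant
  crossings and for \<tau>.\<close>

lemma sigma_commute_whisker:
  assumes i: "1 \<le> i" "i + 1 \<le> n" and h: "h \<in> hom_set M (strands (n - i - 1)) (strands (n - i - 1))"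
  shows "\<sigma> i \<otimes>\<^bsub>G\<^esub> whisker V (i + 1) h = whisker V (i + 1) h \<otimes>\<^bsub>G\<^esub> \<sigma> i"
proof -
  let ?P = "strands (n - i - 1)"
  let ?Q = "V \<triangleright>\<^sub>o\<^bsub>M\<^esub> V \<triangleright>\<^sub>o\<^bsub>M\<^esub> ?P" and ?h = "ident C V \<triangleright>\<^sub>a\<^bsub>M\<^esub> (ident C V \<triangleright>\<^sub>a\<^bsub>M\<^esub> h)"
  have Q: "?Q \<in> Obj M" using V strands_Obj by (simp add: map_obj)
  have s: "crossing V ?P \<in> hom_set M ?Q ?Q"
    using crossing_iso[OF V strands_Obj] by (rule B.iso_arrow_hom)
  have h': "?h \<in> hom_set M ?Q ?Q"
    using V h strands_Obj by (simp add: map_hom map_obj C.A.ident_in_hom)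
  \<comment> \<open>The first \<open>i - 1\<close> strands are common to both arrows; the other two
    are those that cross.\<close>
  have "i + 1 = (i - 1) + 2" using i by simp
  then have "whisker V (i + 1) h = whisker V (i - 1) ?h"
    using whisker_add[OF V strands_Obj h, of "i - 1" 2] whisker_2[OF strands_Obj h] by metis
  then show ?thesis
    using whisker_comp[OF V Q s h', of "i - 1"] whisker_comp[OF V Q h' s, of "i - 1"]
      crossing_interchange[OF V strands_Obj h]
    by (simp add: sigma_eq B.mult_Aut_group)
qed

lemma sigma_commute:
  assumes "1 \<le> i" "i + 2 \<le> j" "j + 1 \<le> n"
  shows "\<sigma> i \<otimes>\<^bsub>G\<^esub> \<sigma> j = \<sigma> j \<otimes>\<^bsub>G\<^esub> \<sigma> i"
proof -
  \<comment> \<open>The number of strands strictly between the two crossings.\<close>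
  define k where "k = j - i - 2"
  let ?s = "crossing V (strands (n - j - 1))"
  have arith: "n - i - 1 = k + ((n - j - 1) + 2)" "j - 1 = (i + 1) + k"
    using assms by (simp_all add: k_def)
  have s: "?s \<in> hom_set M (strands ((n - j - 1) + 2)) (strands ((n - j - 1) + 2))"
    using crossing_strands_iso by (rule B.iso_arrow_hom)
  have "whisker V k ?s \<in> hom_set M (strands (n - i - 1)) (strands (n - i - 1))"
    unfolding arith(1) by (rule B.iso_arrow_hom[OF whisker_strands_iso[OF crossing_strands_iso]])
  moreover have "\<sigma> j = whisker V (i + 1) (whisker V k ?s)"
    unfolding sigma_eq arith(2) by (rule whisker_add[OF V strands_Obj s])
  ultimately show ?thesis
    using sigma_commute_whisker[of i "whisker V k ?s"] assms by simp
qed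

lemma sigma_commute_tau:
  assumes "1 \<le> i" "i + 2 \<le> n"
  shows "\<sigma> i \<otimes>\<^bsub>G\<^esub> \<tau> = \<tau> \<otimes>\<^bsub>G\<^esub> \<sigma> i"
proof -
  \<comment> \<open>The number of strands strictly between the crossing and the last strand, on
    which \<tau> acts.\<close>
  define k where "k = n - i - 2"
  let ?e = "mod_braiding M V N"
  have arith: "n - i - 1 = k + Suc 0" "n - 1 = (i + 1) + k"
    using assms by (simp_all add: k_def)
  have "whisker V k ?e \<in> hom_set M (strands (n - i - 1)) (strands (n - i - 1))"
    unfolding arith(1) by (rule B.iso_arrow_hom[OF whisker_strands_iso[OF mod_braiding_strands_iso]])
  moreover have "\<tau> = whisker V (i + 1) (whisker V k ?e)"
    unfolding arith(2) by (rule whisker_add[OF V strands_Obj B.iso_arrow_hom[OF mod_braiding_strands_iso]])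
  ultimately show ?thesis
    using sigma_commute_whisker[of i "whisker V k ?e"] assms by simp
qed

text \<open>With the \<open>i - 1\<close> common left strands removed, this is
  \<open>crossing_braid\<close> on three strands followed by the remaining ones.\<close>

lemma sigma_braid:
  assumes i: "1 \<le> i" "i + 2 \<le> n"
  shows "\<sigma> i \<otimes>\<^bsub>G\<^esub> \<sigma> (i + 1) \<otimes>\<^bsub>G\<^esub> \<sigma> i = \<sigma> (i + 1) \<otimes>\<^bsub>G\<^esub> \<sigma> i \<otimes>\<^bsub>G\<^esub> \<sigma> (i + 1)"
proof -
  define k where "k = n - i - 2"
  have arith: "n - i - 1 = Suc k" "n - (i + 1) - 1 = k" "i + 1 - 1 = (i - 1) + Suc 0"
    using i by (simp_all add: k_def)
  let ?l = "crossing V (V \<triangleright>\<^sub>o\<^bsub>M\<^esub> strands k)" and ?s = "crossing V (strands k)"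
  let ?r = "ident C V \<triangleright>\<^sub>a\<^bsub>M\<^esub> ?s" and ?Q = "V \<triangleright>\<^sub>o\<^bsub>M\<^esub> V \<triangleright>\<^sub>o\<^bsub>M\<^esub> V \<triangleright>\<^sub>o\<^bsub>M\<^esub> strands k"
  have Q: "?Q \<in> Obj M" using V strands_Obj by (simp add: map_obj)
  have s: "?s \<in> hom_set M (strands (k + 2)) (strands (k + 2))"
    using crossing_strands_iso by (rule B.iso_arrow_hom)
  have l: "?l \<in> hom_set M ?Q ?Q"
    using V strands_Obj by (intro B.iso_arrow_hom crossing_iso) (simp_all add: map_obj)
  have r: "?r \<in> hom_set M ?Q ?Q"
    using map_hom[OF V V strands_Obj strands_Obj C.A.ident_in_hom[OF V] s] by (simp add: strands_Suc del: tensor_pow.simps)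
  \<comment> \<open>The third strand is absorbed into the object to the right of the first crossing;
    for the second crossing, below, the first of the three strands is an extra whisker.\<close>
  have \<sigma>_l: "\<sigma> i = whisker V (i - 1) ?l"
    unfolding sigma_eq arith(1) strands_Suc ..
  have \<sigma>_r: "\<sigma> (i + 1) = whisker V (i - 1) ?r"
    unfolding sigma_eq arith(2,3)
    using whisker_add[OF V strands_Obj s, of "i - 1" "Suc 0"] whisker_1 by simp
  have comp: "whisker V (i - 1) f \<otimes>\<^bsub>G\<^esub> whisker V (i - 1) g \<otimes>\<^bsub>G\<^esub> whisker V (i - 1) f =
      whisker V (i - 1) (f \<bullet>\<^bsub>M\<^esub> g \<bullet>\<^bsub>M\<^esub> f)"
    if "f \<in> hom_set M ?Q ?Q" "g \<in> hom_set M ?Q ?Q" for f g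
    using that Q B.comp_in_hom[OF Q Q Q]
    by (simp add: B.mult_Aut_group B.comp_assoc[of ?Q ?Q ?Q ?Q] flip: whisker_comp[OF V Q])
  show ?thesis
    unfolding \<sigma>_l \<sigma>_r comp[OF l r] comp[OF r l] crossing_braid[OF V strands_Obj] ..
qed

text \<open>Brings the last crossing and \<tau> to the common depth \<open>n - 2\<close>, so that
  their relations can be checked on two strands.\<close>

lemma last_two_strands:
  defines "s \<equiv> crossing V N" and "e \<equiv> ident C V \<triangleright>\<^sub>a\<^bsub>M\<^esub> mod_braiding M V N"
    and "Q \<equiv> V \<triangleright>\<^sub>o\<^bsub>M\<^esub> V \<triangleright>\<^sub>o\<^bsub>M\<^esub> N"
  shows "Q \<in> Obj M" "s \<in> hom_set M Q Q" "e \<in> hom_set M Q Q"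
    and "\<sigma> (n - 1) = whisker V (n - 2) s" "\<tau> = whisker V (n - 2) e"
proof -
  have arith: "n - (n - 1) - 1 = 0" "n - 1 - 1 = n - 2" "n - 1 = (n - 2) + Suc 0"
    using n by simp_all
  have e': "mod_braiding M V N \<in> hom_set M (V \<triangleright>\<^sub>o\<^bsub>M\<^esub> N) (V \<triangleright>\<^sub>o\<^bsub>M\<^esub> N)"
    using V N mod_braiding_iso B.iso_arrow_hom by blast
  show "Q \<in> Obj M"
    unfolding Q_def using V N by (simp add: map_obj)
  show "s \<in> hom_set M Q Q"
    unfolding s_def Q_def using V N by (intro B.iso_arrow_hom crossing_iso)
  show "e \<in> hom_set M Q Q"
    unfolding e_def Q_def using V N e' by (simp add: map_hom map_obj C.A.ident_in_hom)
  show "\<sigma> (n - 1) = whisker V (n - 2) s"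
    \<comment> \<open>No strand is left to the right of the last crossing, and the unit object acts
      trivially on \<open>N\<close>.\<close>
    unfolding sigma_eq arith(1,2) using N by (simp add: s_def act_obj_unit)
  show "\<tau> = whisker V (n - 2) e"
    unfolding arith(3) e_def
    using whisker_add[OF V map_obj[OF V N] e', of "n - 2" "Suc 0"] whisker_1 by simp
qed

section \<open>The relations of type D that involve t\<close>

lemma t_arrow_eq: "t_arrow C M V N n = \<tau> \<otimes>\<^bsub>G\<^esub> \<sigma> (n - 1) \<otimes>\<^bsub>G\<^esub> \<tau>"
proof -
  note local = last_two_strands
  have "t_arrow C M V N n = whisker V (n - 2)
      ((ident C V \<triangleright>\<^sub>a\<^bsub>M\<^esub> mod_braiding M V N) \<bullet>\<^bsub>M\<^esub> crossing V N \<bullet>\<^bsub>M\<^esub> (ident C V \<triangleright>\<^sub>a\<^bsub>M\<^esub> mod_braiding M V N))"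
    by (simp add: t_arrow_def whisker_def crossing_def)
  \<comment> \<open>Whiskering distributes over the three factors. As \<tau> is an involution, t
    becomes a conjugate of the last crossing.\<close>
  also have "\<dots> = \<tau> \<bullet>\<^bsub>M\<^esub> \<sigma> (n - 1) \<bullet>\<^bsub>M\<^esub> \<tau>"
    unfolding local(4,5)
    using local(1-3) B.comp_in_hom[OF local(1,1,1)] by (simp add: whisker_comp[OF V local(1)])
  finally show ?thesis
    using G.m_assoc[of \<tau> "\<sigma> (n - 1)" \<tau>] tau_closed sigma_closed[of "n - 1"] n
    by (simp add: B.mult_Aut_group)
qed

lemma tau_sigma_type_B:
  "\<tau> \<otimes>\<^bsub>G\<^esub> \<sigma> (n - 1) \<otimes>\<^bsub>G\<^esub> \<tau> \<otimes>\<^bsub>G\<^esub> \<sigma> (n - 1) = \<sigma> (n - 1) \<otimes>\<^bsub>G\<^esub> \<tau> \<otimes>\<^bsub>G\<^esub> \<sigma> (n - 1) \<otimes>\<^bsub>G\<^esub> \<tau>"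
proof -
  note local = last_two_strands
  show ?thesis
    unfolding local(4,5) B.mult_Aut_group
    using local(1-3) B.comp_in_hom[OF local(1,1,1)] crossing_mod_braiding[OF V N]
    by (simp add: B.comp_assoc[OF local(1,1,1,1)] flip: whisker_comp[OF V local(1)])
qed

lemma t_closed: "t_arrow C M V N n \<in> carrier G"
  using tau_closed sigma_closed[of "n - 1"] n by (simp add: t_arrow_eq)

text \<open>The two ranges have different reasons: a distant crossing commutes with both factors of
  the conjugate, while for \<open>i = n - 1\<close> the type B relation is used.\<close>

lemma sigma_commute_t:
  assumes "1 \<le> i" "i + 3 \<le> n \<or> i + 1 = n"
  shows "\<sigma> i \<otimes>\<^bsub>G\<^esub> t_arrow C M V N n = t_arrow C M V N n \<otimes>\<^bsub>G\<^esub> \<sigma> i"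
  using assms(2)
proof
  assume "i + 3 \<le> n"
  then show ?thesis
    unfolding t_arrow_eq using assms(1) n
    by (intro G.conj_involution_commute_far sigma_closed tau_closed sigma_commute sigma_commute_tau)
      auto
next
  assume "i + 1 = n"
  then have i: "i = n - 1" and closed: "\<sigma> (n - 1) \<in> carrier G"
    using n sigma_closed by simp_all
  show ?thesis
    unfolding t_arrow_eq i
    by (rule G.conj_involution_commute[OF closed tau_closed tau_sigma_type_B])
qed

text \<open>The crossing with index \<open>n - 2\<close> commutes with \<tau>, so its braid relation
  with the last crossing can be conjugated by \<tau>.\<close>

lemma sigma_t_braid:
  assumes "3 \<le> n"
  shows "\<sigma> (n - 2) \<otimes>\<^bsub>G\<^esub> t_arrow C M V N n \<otimes>\<^bsub>G\<^esub> \<sigma> (n - 2) =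
    t_arrow C M V N n \<otimes>\<^bsub>G\<^esub> \<sigma> (n - 2) \<otimes>\<^bsub>G\<^esub> t_arrow C M V N n"
proof -
  have "n - 2 + 1 = n - 1" using assms by simp
  then show ?thesis
    unfolding t_arrow_eq using assms sigma_braid[of "n - 2"]
    by (intro G.conj_involution_braid sigma_closed tau_closed tau_involution sigma_commute_tau) auto
qed

section \<open>Descent to the presented group\<close>

definition brD_image :: "brD_letter \<Rightarrow> 'm" where
  "brD_image x = (case x of Sigma i \<Rightarrow> \<sigma> i | Tau \<Rightarrow> t_arrow C M V N n)"

lemma brD_image_closed: "brD_image \<in> brD_letters n \<rightarrow> carrier G"
  using t_closed sigma_closed by (auto simp: brD_image_def brD_letters_def)

lemma brD_image_relations:
  assumes "(l, r) \<in> brD_relations n"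
  shows "word_eval G brD_image l = word_eval G brD_image r"
proof -
  \<comment> \<open>The defining relations allow either order of the indices, whereas
    \<open>sigma_commute\<close> needs the smaller one first.\<close>
  have far_commute: "\<sigma> i \<otimes>\<^bsub>G\<^esub> \<sigma> j = \<sigma> j \<otimes>\<^bsub>G\<^esub> \<sigma> i"
    if "i \<in> {1..n - 1}" "j \<in> {1..n - 1}" "\<bar>int i - int j\<bar> \<ge> 2" for i j
    using that sigma_commute[of i j] sigma_commute[of j i] by (cases "i < j") auto
  \<comment> \<open>One case for each family of relations. For \<open>n = 2\<close> only the third
    occurs, with \<open>i = 1\<close>.\<close>
  consider (braid) i where "1 \<le> i" "i + 2 \<le> n"
      "l = [(Sigma i, True), (Sigma (i + 1), True), (Sigma i, True)]"
      "r = [(Sigma (i + 1), True), (Sigma i, True), (Sigma (i + 1), True)]"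
    | (far) i j where "i \<in> {1..n - 1}" "j \<in> {1..n - 1}" "\<bar>int i - int j\<bar> \<ge> 2"
      "l = [(Sigma i, True), (Sigma j, True)]" "r = [(Sigma j, True), (Sigma i, True)]"
    | (t) i where "1 \<le> i" "i + 3 \<le> n \<or> i + 1 = n"
      "l = [(Sigma i, True), (Tau, True)]" "r = [(Tau, True), (Sigma i, True)]"
    | (t_braid) "n \<ge> 3" "l = [(Sigma (n - 2), True), (Tau, True), (Sigma (n - 2), True)]"
      "r = [(Tau, True), (Sigma (n - 2), True), (Tau, True)]"
    using assms unfolding brD_relations_def Let_def by (auto split: if_splits)
  then show ?thesis
  proof cases
    case braid
    then show ?thesis
      using sigma_braid[of i] sigma_closed[of i] sigma_closed[of "i + 1"]
      by (simp add: brD_image_def G.m_assoc)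
  next
    case far
    then show ?thesis
      using far_commute[of i j] sigma_closed[of i] sigma_closed[of j]
      by (auto simp: brD_image_def)
  next
    case t
    have "\<sigma> i \<in> carrier G"
      using t(1,2) n sigma_closed by auto
    then show ?thesis
      using sigma_commute_t[OF t(1,2)] t_closed by (simp add: t(3,4) brD_image_def)
  next
    case t_braid
    then show ?thesis
      using sigma_t_braid sigma_closed[of "n - 2"] t_closed by (simp add: brD_image_def G.m_assoc)
  qed
qed

theorem BrD_representation:
  "\<exists>!\<rho>. \<rho> \<in> extensional (carrier (BrD n)) \<and> group_hom (BrD n) G \<rho> \<and>
    (\<forall>i\<in>{1..n - 1}. \<rho> (BrD_sigma n i) = \<sigma> i) \<and> \<rho> (BrD_t n) = t_arrow C M V N n"
proof -
  \<comment> \<open>Splits the condition on all letters into those on the crossings and on t, so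
    that the universal property takes the required form.\<close>
  have "(\<forall>x\<in>brD_letters n. \<rho> (presented_gen (brD_letters n) (brD_relations n) x) = brD_image x) \<longleftrightarrow>
      (\<forall>i\<in>{1..n - 1}. \<rho> (BrD_sigma n i) = \<sigma> i) \<and> \<rho> (BrD_t n) = t_arrow C M V N n" for \<rho>
    by (auto simp: brD_letters_def BrD_sigma_def BrD_t_def brD_image_def)
  then show ?thesis
    using G.presented_group_universal[OF brD_image_closed, of "brD_relations n", OF brD_image_relations]
    by (simp only: BrD_def)
qed

end

theorem proposition3p10:
  fixes K :: "('k, 'y) ring_scheme"
    and C :: "('co, 'cm, 'k, 'z) braided_cat_scheme"
    and M :: "('o, 'm, 'k, 'co, 'cm, 'w) braided_mod_cat_scheme"
    and V :: 'co and N :: 'o and n :: nat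
  assumes "algebraically_closed K"
    and "characteristic_zero K"
    and "braided_monoidal_category K C"
    and "symmetric_module_category K C M"
    and "V \<in> Obj C"
    and "N \<in> Obj M"
    and "n \<ge> 2"
  shows "\<exists>!\<rho>. \<rho> \<in> extensional (carrier (BrD n)) \<and>
      group_hom (BrD n) (Aut_group M (tensor_pow C V n \<triangleright>\<^sub>o\<^bsub>M\<^esub> N)) \<rho> \<and>
      (\<forall>i\<in>{1..n - 1}. \<rho> (BrD_sigma n i) = sigma_arrow C M V N n i) \<and>
      \<rho> (BrD_t n) = t_arrow C M V N n"
proof -
  interpret symmetric_module_category K C M by fact
  interpret type_D_action K C M V N n
    using assms(5-7) by unfold_locales
  show ?thesis by (rule BrD_representation)
qed

end
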